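(* Let $X$ be a Banach space. The following assertions are equivalent: (i) $X$ is octahedral; (ii) for every separable subspace $Y\subset X$ there exists $x^{**}\in S_{X^{**}}$ such that $\|y+\lambda x^{**}\|=\|y\|+|\lambda|$ for every $y\in Y$ and $\lambda\in\mathbb R$; (iii) $X^*$ has the weak$^*$ SD2P; (iv) $X^*$ has the weak$^*$ SD2P$_\omega$.
   Context: Banach spaces are real and infinite-dimensional. $B_X$ and $S_X$ are the closed unit ball and unit sphere of $X$; $X$ is regarded as a subspace of $X^{**}$ canonically. $X$ is octahedral if for every finite-dimensional subspace $Y\subset X$ and every $\varepsilon>0$ there is $x\in S_X$ such that $\|y+\lambda x\|\ge(1-\varepsilon)(\|y\|+|\lambda|)$ for every $y\in Y$ and $\lambda\in\mathbb R$. A slice of the unit ball $B_Z$ of a normed space $Z$ defined by $z^*\in S_{Z^*}$ is a set $\{z\in B_Z: z^*(z)\ge 1-\varepsilon\}$ with $\varepsilon\in(0,1)$. $X^*$ has the weak$^*$ SD2P if every finite convex combination $\sum_{i=1}^n\lambda_iS_i$ ($\lambda_i\ge0$, $\sum_i\lambda_i=1$) of slices $S_i$ of $B_{X^*}$ defined by functionals in $S_X\subset S_{X^{**}}$ intersects $B_{X^*}\setminus\lambda B_{X^*}$ for every $\lambda\in(0,1)$. $X^*$ has the weak$^*$ SD2P$_\omega$ if for every countable set $A\subset S_X$ and every $\lambda\in(0,1)$ there are $B\subset S_{X^*}$ and $x^{**}\in S_{X^{**}}$ such that for every $x\in A$ there is $x^*\in B$ with $x^*(x)\ge\lambda$, and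 $x^{**}(x^* )\ge\lambda$ for every $x^*\in B$. *)

theory Defs
  imports "HOL-Analysis.Analysis"
begin

text \<open>The dual of a real normed space \<open>'a\<close> is \<open>'a \<Rightarrow>\<^sub>L real\<close> with the operator norm, and unit
  balls and spheres are \<open>cball 0 1\<close> and \<open>sphere 0 1\<close>. Subspaces are linear subspaces, not
  necessarily closed. A property of the whole space takes an \<open>itself\<close> argument.\<close>

type_synonym 'a dual = "'a \<Rightarrow>\<^sub>L real"
type_synonym 'a bidual = "'a dual \<Rightarrow>\<^sub>L real"

definition to_bidual :: "'a::real_normed_vector \<Rightarrow> 'a bidual" where
  "to_bidual x = Blinfun (\<lambda>f. blinfun_apply f x)"

lemma to_bidual_apply [simp]: "blinfun_apply (to_bidual x) f = blinfun_apply f x"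
  unfolding to_bidual_def
  by (simp add: bounded_linear_Blinfun_apply blinfun.bounded_linear_left)

definition finite_dim :: "'a::real_vector set \<Rightarrow> bool" where
  "finite_dim Y \<longleftrightarrow> (\<exists>F. finite F \<and> Y = span F)"

definition octahedral :: "'a::real_normed_vector itself \<Rightarrow> bool" where
  "octahedral _ \<longleftrightarrow>
    (\<forall>Y::'a set. \<forall>\<epsilon>::real. subspace Y \<and> finite_dim Y \<and> \<epsilon> > 0 \<longrightarrow>
      (\<exists>x\<in>sphere 0 1. \<forall>y\<in>Y. \<forall>t::real.
        norm (y + t *\<^sub>R x) \<ge> (1 - \<epsilon>) * (norm y + \<bar>t\<bar>)))"

definition slice :: "'z::real_normed_vector dual \<Rightarrow> real \<Rightarrow> 'z set" where
  "slice g \<epsilon> = {z \<in> cball 0 1. blinfun_apply g z \<ge> 1 - \<epsilon>}"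

definition weak_star_slice :: "'a::real_normed_vector dual set \<Rightarrow> bool" where
  "weak_star_slice S \<longleftrightarrow>
    (\<exists>x\<in>sphere 0 1. \<exists>\<epsilon>. 0 < \<epsilon> \<and> \<epsilon> < 1 \<and> S = slice (to_bidual x) \<epsilon>)"

definition set_combination ::
  "nat \<Rightarrow> (nat \<Rightarrow> real) \<Rightarrow> (nat \<Rightarrow> 'z::real_vector set) \<Rightarrow> 'z set" where
  "set_combination n c S = {(\<Sum>i=1..n. c i *\<^sub>R z i) | z. \<forall>i\<in>{1..n}. z i \<in> S i}"

text \<open>In the next two definitions the argument is \<open>X\<close>, although the property is one of its dual:
  the weak-star topology depends on the chosen predual.\<close>

definition dual_weak_star_SD2P :: "'a::real_normed_vector itself \<Rightarrow> bool" where
  "dual_weak_star_SD2P _ \<longleftrightarrow>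
    (\<forall>n (c :: nat \<Rightarrow> real) (S :: nat \<Rightarrow> 'a dual set).
      (\<forall>i\<in>{1..n}. c i \<ge> 0 \<and> weak_star_slice (S i)) \<and> (\<Sum>i=1..n. c i) = 1 \<longrightarrow>
      (\<forall>t::real. 0 < t \<and> t < 1 \<longrightarrow>
        set_combination n c S \<inter> (cball 0 1 - (*\<^sub>R) t ` cball 0 1) \<noteq> {}))"

definition dual_weak_star_SD2P_omega :: "'a::real_normed_vector itself \<Rightarrow> bool" where
  "dual_weak_star_SD2P_omega _ \<longleftrightarrow>
    (\<forall>(A :: 'a set) (t::real). countable A \<and> A \<subseteq> sphere 0 1 \<and> 0 < t \<and> t < 1 \<longrightarrow>
      (\<exists>(B :: 'a dual set) (g :: 'a bidual). B \<subseteq> sphere 0 1 \<and> g \<in> sphere 0 1 \<and>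
        (\<forall>x\<in>A. \<exists>f\<in>B. blinfun_apply f x \<ge> t) \<and>
        (\<forall>f\<in>B. blinfun_apply g f \<ge> t)))"

end

theory Submission
  imports Defs
begin

text \<open>The implications are proved around the cycle octahedral, bidual functional,
  \<open>SD2P_omega\<close>, \<open>SD2P\<close>, octahedral.

  The substantial step is \<open>octahedral_imp_bidual\<close>. Weak-star limits of unit vectors are of no direct
  help, because the norm can drop in the limit. Instead, let \<open>d\<close> be a dense sequence of the separable
  subspace, and use octahedrality repeatedly to choose unit vectors \<open>x n\<close>, each almost
  \<open>l1\<close>-orthogonal to the span of \<open>d 0, \<dots>, d n\<close> and of the earlier \<open>x i\<close>. With errors tending to
  zero fast enough, \<open>d j\<close> and the tail of \<open>x\<close> after any \<open>k \<ge> j\<close> span almost isometrically an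
  \<open>l1\<close>-sum. This is exactly what is needed for a functional \<open>f j k\<close> in the dual ball that nearly
  norms \<open>d j\<close> and, simultaneously, all \<open>x i\<close> with \<open>i > k\<close>, the error tending to zero as \<open>k\<close> grows.
  The same lower bounds hold at the \<open>f j k\<close> for some \<open>g\<close> in the bidual ball, because finitely many of
  the \<open>f j k\<close> satisfy them at a common \<open>x i\<close>. For \<open>t \<ge> 0\<close> the functionals \<open>f j k\<close>, \<open>k \<ge> j\<close>, then
  witness that \<open>d j + t g\<close> has norm \<open>norm (d j) + t\<close>.

  Both \<open>f j k\<close> and \<open>g\<close> are instances of one extension theorem, \<open>Mazur_Orlicz_dual\<close>: lower bounds
  \<open>c i\<close> at vectors \<open>v i\<close> are met simultaneously by a functional of norm at most 1 provided that
  no finite combination with nonnegative coefficients makes them exceed the norm. It is a form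
  of the Hahn--Banach theorem, proved here from the fact that minimal sublinear functionals are
  linear.

  From such a \<open>g\<close>, a functional nearly norming \<open>x + g\<close> is near 1 both at \<open>x\<close> and under \<open>g\<close>; the set of
  these functionals witnesses \<open>SD2P_omega\<close>. The functional \<open>g\<close> then keeps the norm of every convex
  combination of them close to 1, which gives \<open>SD2P\<close>.

  Back to octahedrality, \<open>SD2P_common_direction\<close> applies \<open>SD2P\<close> to a single combination, the
  arithmetic mean over the weak-star slices given by a finite net of the unit sphere. If the mean of
  \<open>n\<close> functionals in the unit ball is at least \<open>1 - \<eta> / n\<close> at a unit vector \<open>x\<close>, then each of them
  is at least \<open>1 - \<eta>\<close> at \<open>x\<close>; so \<open>x\<close> is a direction good for all points of the net. The net exists
  because bounded sets of a finite-dimensional subspace are totally bounded.\<close>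

section \<open>Sublinear functionals and the Mazur--Orlicz theorem\<close>

definition sublinear :: "('a::real_vector \<Rightarrow> real) \<Rightarrow> bool" where
  "sublinear p \<longleftrightarrow> (\<forall>x y. p (x + y) \<le> p x + p y) \<and> (\<forall>t x. t \<ge> 0 \<longrightarrow> p (t *\<^sub>R x) = t * p x)"

lemma sublinearI:
  assumes add: "\<And>x y. p (x + y) \<le> p x + p y"
    and scale: "\<And>t x. t > 0 \<Longrightarrow> p (t *\<^sub>R x) \<le> t * p x"
  shows "sublinear p"
proof -
  have "p 0 = 0"
    using scale[of 2 0] scale[of "1/2" 0] by simp
  moreover have "p (t *\<^sub>R x) = t * p x" if "t > 0" for t x
  proof -
    have "p x \<le> inverse t * p (t *\<^sub>R x)"
      using scale[of "inverse t" "t *\<^sub>R x"] that by simp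
    with that have "t * p x \<le> p (t *\<^sub>R x)"
      by (simp add: field_simps)
    with scale[OF that, of x] show ?thesis
      by simp
  qed
  ultimately show ?thesis
    unfolding sublinear_def using add by (auto simp: order_le_less)
qed

lemma sublinear_zero: "sublinear p \<Longrightarrow> p 0 = 0"
  unfolding sublinear_def by (force dest: spec[of _ 0])

lemma sublinear_ge_minus:
  assumes "sublinear p"
  shows "- p (- x) \<le> p x"
proof -
  have "p (x + - x) \<le> p x + p (- x)"
    using assms unfolding sublinear_def by blast
  then show ?thesis
    using sublinear_zero[OF assms] by simp
qed

lemma sublinear_norm: "sublinear norm"
  by (rule sublinearI) (auto simp: norm_triangle_ineq)

text \<open>Lowering \<open>p\<close> to the infimum of \<open>p (x + v) - c\<close> over the cone forces every linear functional
  below the result to be at least \<open>c\<close> at \<open>v\<close>. The hypothesis keeps the infimum finite, since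
  \<open>- p (- x)\<close> is a lower bound. The construction serves both to impose lower bounds and, with a ray
  as cone, to show that minimal sublinear functionals are linear.\<close>

lemma sublinear_below_cone:
  fixes p :: "'a::real_vector \<Rightarrow> real"
  assumes p: "sublinear p" and C: "convex_cone C" and le: "\<And>v c. (v, c) \<in> C \<Longrightarrow> c \<le> p v"
  obtains q where "sublinear q" "\<And>x. q x \<le> p x" "\<And>v c. (v, c) \<in> C \<Longrightarrow> c \<le> - q (- v)"
proof -
  define q where "q = (\<lambda>x. INF w\<in>C. p (x + fst w) - snd w)"
  have zero: "(0, 0) \<in> C"
    using C by (simp add: convex_cone_iff zero_prod_def)
  then have ne: "C \<noteq> {}"
    by blast
  have "- p (- x) \<le> p (x + fst w) - snd w" if "w \<in> C" for x w
  proof -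
    have "p (fst w) \<le> p (x + fst w) + p (- x)"
      using p[unfolded sublinear_def, THEN conjunct1, rule_format, of "x + fst w" "- x"] by simp
    with le[of "fst w" "snd w"] that show ?thesis
      by simp
  qed
  then have bdd: "bdd_below ((\<lambda>w. p (x + fst w) - snd w) ` C)" for x
    by (meson bdd_belowI2)
  have lower: "q x \<le> p (x + v) - c" if "(v, c) \<in> C" for x v c
    unfolding q_def using cINF_lower[OF bdd that] by simp
  have greatest: "r \<le> q x" if "\<And>v c. (v, c) \<in> C \<Longrightarrow> r \<le> p (x + v) - c" for r x
    unfolding q_def using that by (intro cINF_greatest[OF ne]) (metis prod.collapse)
  have "sublinear q"
  proof (rule sublinearI)
    fix x y
    have "q (x + y) - (p (x + v) - c) \<le> q y" if v: "(v, c) \<in> C" for v c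
    proof (rule greatest)
      fix w d
      assume w: "(w, d) \<in> C"
      have "(v + w, c + d) \<in> C"
        using convex_cone_add[OF C v w] by simp
      then have "q (x + y) \<le> p ((x + v) + (y + w)) - (c + d)"
        using lower[of "v + w" "c + d" "x + y"] by (simp add: algebra_simps)
      also have "\<dots> \<le> p (x + v) + p (y + w) - (c + d)"
        using p by (simp add: sublinear_def)
      finally show "q (x + y) - (p (x + v) - c) \<le> p (y + w) - d"
        by simp
    qed
    then have "q (x + y) - q y \<le> q x"
      by (intro greatest) force
    then show "q (x + y) \<le> q x + q y"
      by simp
  next
    fix t :: real and x
    assume t: "t > 0"
    have "q (t *\<^sub>R x) / t \<le> q x"
    proof (rule greatest)
      fix v c
      assume "(v, c) \<in> C"
      then have "(t *\<^sub>R v, t * c) \<in> C"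
        using C t unfolding convex_cone_iff by (metis less_imp_le scaleR_Pair real_scaleR_def)
      then have "q (t *\<^sub>R x) \<le> p (t *\<^sub>R (x + v)) - t * c"
        using lower by (simp add: scaleR_add_right)
      also have "\<dots> = t * (p (x + v) - c)"
        using p t by (simp add: sublinear_def right_diff_distrib)
      finally show "q (t *\<^sub>R x) / t \<le> p (x + v) - c"
        using t by (simp add: field_simps)
    qed
    then show "q (t *\<^sub>R x) \<le> t * q x"
      using t by (simp add: field_simps)
  qed
  moreover have "q x \<le> p x" for x
    using lower[OF zero, of x] by simp
  moreover have "c \<le> - q (- v)" if "(v, c) \<in> C" for v c
    using lower[OF that, of "- v"] sublinear_zero[OF p] by simp
  ultimately show thesis
    using that by blast
qed

text \<open>Zorn's lemma: the pointwise infimum of a chain is again sublinear, because any two members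
  of a chain have a common lower bound in it.\<close>

lemma minimal_sublinear_below:
  fixes p :: "'a::real_vector \<Rightarrow> real"
  assumes p: "sublinear p"
  obtains m where "sublinear m" "m \<le> p" "\<And>q. sublinear q \<Longrightarrow> q \<le> m \<Longrightarrow> q = m"
proof -
  define A where "A = {q. sublinear q \<and> q \<le> p}"
  have po: "partial_order_on A (relation_of (\<lambda>a b. b \<le> a) A)"
    by (auto simp: partial_order_on_def preorder_on_def refl_on_def trans_def antisym_def
        relation_of_def)
  have "\<exists>u\<in>A. \<forall>q\<in>K. u \<le> q" if K: "K \<in> Chains (relation_of (\<lambda>a b. b \<le> a) A)" for K
  proof (cases "K = {}")
    case True
    then show ?thesis
      using p by (auto simp: A_def)
  next
    case False
    have sub: "sublinear q" and below: "q \<le> p" if "q \<in> K" for q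
      using K that unfolding Chains_def relation_of_def A_def by auto
    have chain: "q \<le> r \<or> r \<le> q" if "q \<in> K" "r \<in> K" for q r
      using K that unfolding Chains_def relation_of_def by auto
    define u where "u = (\<lambda>x. INF q\<in>K. q x)"
    have "- p (- x) \<le> q x" if "q \<in> K" for q x
      using sublinear_ge_minus[OF sub[OF that], of x] below[OF that]
      by (meson le_funD neg_le_iff_le order_trans)
    then have bdd: "bdd_below ((\<lambda>q. q x) ` K)" for x
      by (meson bdd_belowI2)
    have lower: "u x \<le> q x" if "q \<in> K" for q x
      unfolding u_def using cINF_lower[OF bdd that] .
    have greatest: "r \<le> u x" if "\<And>q. q \<in> K \<Longrightarrow> r \<le> q x" for r x
      unfolding u_def using that by (intro cINF_greatest[OF False])
    have "sublinear u"
    proof (rule sublinearI)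
      fix x y
      have sum: "u (x + y) \<le> q x + r y" if "q \<in> K" "r \<in> K" for q r
      proof -
        obtain s where s: "s \<in> K" "s \<le> q" "s \<le> r"
          using chain[OF \<open>q \<in> K\<close> \<open>r \<in> K\<close>] \<open>q \<in> K\<close> \<open>r \<in> K\<close> by blast
        have "u (x + y) \<le> s (x + y)"
          using lower s by blast
        also have "\<dots> \<le> s x + s y"
          using sub s by (simp add: sublinear_def)
        also have "\<dots> \<le> q x + r y"
          using s by (simp add: add_mono le_funD)
        finally show ?thesis .
      qed
      have "u (x + y) - q x \<le> u y" if "q \<in> K" for q
        using sum[OF that] by (intro greatest) force
      then have "u (x + y) - u y \<le> u x"
        by (intro greatest) force
      then show "u (x + y) \<le> u x + u y"
        by simp
    next
      fix t :: real and x
      assume t: "t > 0"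
      have "u (t *\<^sub>R x) / t \<le> u x"
      proof (rule greatest)
        fix q
        assume q: "q \<in> K"
        have "u (t *\<^sub>R x) \<le> t * q x"
          using lower[OF q, of "t *\<^sub>R x"] sub[OF q] t by (simp add: sublinear_def)
        then show "u (t *\<^sub>R x) / t \<le> q x"
          using t by (simp add: field_simps)
      qed
      then show "u (t *\<^sub>R x) \<le> t * u x"
        using t by (simp add: field_simps)
    qed
    moreover have "u \<le> p"
      using False lower below by (meson all_not_in_conv le_fun_def order_trans)
    ultimately show ?thesis
      using lower by (auto simp: A_def le_fun_def)
  qed
  from predicate_Zorn[OF po this] obtain m where "m \<in> A" "\<forall>q\<in>A. q \<le> m \<longrightarrow> q = m"
    by blast
  then show thesis
    using that unfolding A_def by (metis (mono_tags, lifting) mem_Collect_eq order_trans)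
qed

text \<open>The cone is the ray through \<open>(y, m y)\<close>. By minimality, lowering \<open>m\<close> along it does not change
  \<open>m\<close>, so \<open>m y \<le> - m (- y)\<close>. A sublinear functional that is odd is linear.\<close>

lemma minimal_sublinear_linear:
  assumes m: "sublinear m" and min: "\<And>q. sublinear q \<Longrightarrow> q \<le> m \<Longrightarrow> q = m"
  shows "linear m"
proof -
  have scale: "m (t *\<^sub>R x) = t * m x" if "t \<ge> 0" for t x
    using m that by (simp add: sublinear_def)
  have minus: "m (- y) = - m y" for y
  proof -
    \<comment> \<open>The absolute value parametrizes the nonnegative multiples by all reals.\<close>
    define C where "C = range (\<lambda>t. (\<bar>t\<bar> *\<^sub>R y, \<bar>t\<bar> * m y))"
    have C: "convex_cone C"
      unfolding convex_cone_iff
    proof (intro conjI ballI allI impI)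
      show "0 \<in> C"
        unfolding C_def by (rule range_eqI[of _ _ 0]) (simp add: zero_prod_def)
      show "a + b \<in> C" if "a \<in> C" "b \<in> C" for a b
      proof -
        from that obtain s t where "a = (\<bar>s\<bar> *\<^sub>R y, \<bar>s\<bar> * m y)" "b = (\<bar>t\<bar> *\<^sub>R y, \<bar>t\<bar> * m y)"
          unfolding C_def by blast
        then show ?thesis
          unfolding C_def by (intro range_eqI[of _ _ "\<bar>s\<bar> + \<bar>t\<bar>"]) (simp add: algebra_simps)
      qed
      show "c *\<^sub>R a \<in> C" if "a \<in> C" "c \<ge> 0" for a c
      proof -
        from that obtain s where "a = (\<bar>s\<bar> *\<^sub>R y, \<bar>s\<bar> * m y)"
          unfolding C_def by blast
        with that show ?thesis
          unfolding C_def by (intro range_eqI[of _ _ "c * s"]) (simp add: abs_mult)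
      qed
    qed
    have le: "c \<le> m v" if "(v, c) \<in> C" for v c
      using that by (auto simp: scale C_def)
    obtain q where q: "sublinear q" "\<And>x. q x \<le> m x" "\<And>v c. (v, c) \<in> C \<Longrightarrow> c \<le> - q (- v)"
      using sublinear_below_cone[OF m C le] by blast
    then have "q = m"
      by (intro min) (auto simp: le_fun_def)
    moreover have "(y, m y) \<in> C"
      unfolding C_def by (rule range_eqI[of _ _ 1]) simp
    ultimately have "m y \<le> - m (- y)"
      using q(3) by blast
    with sublinear_ge_minus[OF m, of y] show ?thesis
      by simp
  qed
  show ?thesis
  proof (rule linearI)
    fix x y
    have "m ((- x) + (- y)) \<le> m (- x) + m (- y)"
      using m unfolding sublinear_def by blast
    then have "m (- (x + y)) \<le> m (- x) + m (- y)"
      by simp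
    moreover have "m (x + y) \<le> m x + m y"
      using m unfolding sublinear_def by blast
    ultimately show "m (x + y) = m x + m y"
      unfolding minus by simp
  next
    fix t x
    show "m (t *\<^sub>R x) = t *\<^sub>R m x"
      using scale[of t x] scale[of "- t" x] minus[of "t *\<^sub>R x"] by (cases "t \<ge> 0") auto
  qed
qed

lemma linear_below_above_cone:
  fixes p :: "'a::real_vector \<Rightarrow> real"
  assumes "sublinear p" "convex_cone C" "\<And>v c. (v, c) \<in> C \<Longrightarrow> c \<le> p v"
  obtains h where "linear h" "\<And>x. h x \<le> p x" "\<And>v c. (v, c) \<in> C \<Longrightarrow> c \<le> h v"
proof -
  obtain q where q: "sublinear q" "\<And>x. q x \<le> p x" "\<And>v c. (v, c) \<in> C \<Longrightarrow> c \<le> - q (- v)"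
    using sublinear_below_cone assms by metis
  obtain m where m: "sublinear m" "m \<le> q" "\<And>r. sublinear r \<Longrightarrow> r \<le> m \<Longrightarrow> r = m"
    using minimal_sublinear_below[OF q(1)] by metis
  have lin: "linear m"
    using minimal_sublinear_linear m by blast
  show thesis
  proof (rule that[OF lin])
    show "m x \<le> p x" for x
      using m(2) q(2) by (meson le_funD order_trans)
    show "c \<le> m v" if "(v, c) \<in> C" for v c
      using q(3)[OF that] m(2) linear_neg[OF lin, of v] by (simp add: le_fun_def) (smt (verit))
  qed
qed

text \<open>The Mazur--Orlicz theorem for the norm. The nonnegative combinations of the pairs
  \<open>(v i, c i)\<close> form a cone on which the required bounds and the hypothesis become those of
  \<open>linear_below_above_cone\<close>.\<close>

lemma Mazur_Orlicz_dual:
  fixes v :: "'i \<Rightarrow> 'a::real_normed_vector"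
  assumes le: "\<And>F a. finite F \<Longrightarrow> F \<subseteq> I \<Longrightarrow> (\<And>i. a i \<ge> 0) \<Longrightarrow>
      (\<Sum>i\<in>F. a i * c i) \<le> norm (\<Sum>i\<in>F. a i *\<^sub>R v i)"
  obtains h :: "'a dual" where "norm h \<le> 1" "\<And>i. i \<in> I \<Longrightarrow> c i \<le> blinfun_apply h (v i)"
proof -
  define C where "C = {\<Sum>i\<in>F. a i *\<^sub>R (v i, c i) |F a. finite F \<and> F \<subseteq> I \<and> (\<forall>i. a i \<ge> 0)}"
  have "convex_cone C"
    unfolding convex_cone_iff
  proof (intro conjI ballI allI impI)
    show "0 \<in> C"
      unfolding C_def by (rule CollectI, rule exI[of _ "{}"]) (auto intro: exI[of _ "\<lambda>_. 0"])
  next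
    fix x y
    assume "x \<in> C" "y \<in> C"
    then obtain F a G b where
        x: "x = (\<Sum>i\<in>F. a i *\<^sub>R (v i, c i))" "finite F" "F \<subseteq> I" "\<And>i. a i \<ge> 0"
      and y: "y = (\<Sum>i\<in>G. b i *\<^sub>R (v i, c i))" "finite G" "G \<subseteq> I" "\<And>i. b i \<ge> 0"
      unfolding C_def by blast
    define e where "e i = (if i \<in> F then a i else 0) + (if i \<in> G then b i else 0)" for i
    have "x = (\<Sum>i\<in>F \<union> G. (if i \<in> F then a i else 0) *\<^sub>R (v i, c i))"
      unfolding x(1) using x(2) y(2)
      by (intro sum.mono_neutral_cong_left) (auto simp flip: zero_prod_def)
    moreover have "y = (\<Sum>i\<in>F \<union> G. (if i \<in> G then b i else 0) *\<^sub>R (v i, c i))"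
      unfolding y(1) using x(2) y(2)
      by (intro sum.mono_neutral_cong_left) (auto simp flip: zero_prod_def)
    ultimately have "x + y = (\<Sum>i\<in>F \<union> G. e i *\<^sub>R (v i, c i))"
      by (simp only: e_def sum.distrib scaleR_add_left)
    moreover have "finite (F \<union> G)" "F \<union> G \<subseteq> I" "\<forall>i. e i \<ge> 0"
      using x y by (auto simp: e_def)
    ultimately show "x + y \<in> C"
      unfolding C_def by blast
  next
    fix x and t :: real
    assume "x \<in> C" and t: "t \<ge> 0"
    then obtain F a where
        x: "x = (\<Sum>i\<in>F. a i *\<^sub>R (v i, c i))" "finite F" "F \<subseteq> I" "\<And>i. a i \<ge> 0"
      unfolding C_def by blast
    then have "t *\<^sub>R x = (\<Sum>i\<in>F. (t * a i) *\<^sub>R (v i, c i))"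
      by (simp add: scaleR_sum_right mult.assoc)
    moreover have "\<forall>i. t * a i \<ge> 0"
      using x t by simp
    ultimately show "t *\<^sub>R x \<in> C"
      unfolding C_def using x(2,3) by (intro CollectI exI[of _ F] exI[of _ "\<lambda>i. t * a i"]) blast
  qed
  moreover have "d \<le> norm w" if "(w, d) \<in> C" for w d
  proof -
    from that obtain F a where F: "(w, d) = (\<Sum>i\<in>F. a i *\<^sub>R (v i, c i))"
        "finite F" "F \<subseteq> I" "\<And>i. a i \<ge> 0"
      unfolding C_def by blast
    then have "w = (\<Sum>i\<in>F. a i *\<^sub>R v i)" "d = (\<Sum>i\<in>F. a i * c i)"
      by (simp_all add: prod_eq_iff fst_sum snd_sum)
    with le[OF F(2,3,4)] show ?thesis
      by simp
  qed
  ultimately obtain h where h: "linear h" "\<And>x. h x \<le> norm x" "\<And>w d. (w, d) \<in> C \<Longrightarrow> d \<le> h w"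
    using linear_below_above_cone[OF sublinear_norm, of C] by metis
  have bound: "\<bar>h x\<bar> \<le> 1 * norm x" for x
    using h(2)[of x] h(2)[of "- x"] linear_neg[OF h(1), of x] by simp
  then have bl: "bounded_linear h"
    using h(1) by (intro bounded_linear_intro[of h 1])
      (auto simp: linear_add linear_scale)
  show thesis
  proof
    show "norm (Blinfun h) \<le> 1"
      using bound by (intro norm_blinfun_bound) (auto simp: bounded_linear_Blinfun_apply[OF bl])
    fix i
    assume "i \<in> I"
    then have "(v i, c i) \<in> C"
      unfolding C_def by (intro CollectI exI[of _ "{i}"] exI[of _ "\<lambda>_. 1"]) auto
    then show "c i \<le> blinfun_apply (Blinfun h) (v i)"
      using h(3) by (simp add: bounded_linear_Blinfun_apply[OF bl])
  qed
qed

section \<open>Functionals and the canonical embedding\<close>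

lemma unit_vector_above:
  fixes T :: "'b::real_normed_vector \<Rightarrow>\<^sub>L real"
  assumes "r < norm T" "0 \<le> r"
  obtains x where "norm x = 1" "r < blinfun_apply T x"
proof -
  have "norm T \<le> r" if le: "\<And>x. norm x = 1 \<Longrightarrow> blinfun_apply T x \<le> r"
  proof (rule norm_blinfun_bound[OF \<open>0 \<le> r\<close>])
    fix x
    show "norm (blinfun_apply T x) \<le> r * norm x"
    proof (cases "x = 0")
      case True
      then show ?thesis
        by simp
    next
      case False
      then have "blinfun_apply T (x /\<^sub>R norm x) \<le> r" "blinfun_apply T (- x /\<^sub>R norm x) \<le> r"
        by (auto intro!: le)
      with False show ?thesis
        by (simp add: blinfun.scaleR_right blinfun.minus_right field_simps abs_le_iff)
    qed
  qed
  with assms that show thesis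
    by (meson not_less)
qed

lemma blinfun_apply_le:
  fixes f :: "'b::real_normed_vector \<Rightarrow>\<^sub>L real"
  shows "blinfun_apply f x \<le> norm f * norm x"
  using norm_blinfun[of f x] by simp

lemma blinfun_unit_ball_le:
  fixes f :: "'b::real_normed_vector \<Rightarrow>\<^sub>L real"
  assumes "norm f \<le> 1"
  shows "blinfun_apply f x \<le> norm x"
  using blinfun_apply_le[of f x] mult_right_mono[OF assms norm_ge_zero[of x]] by simp

lemma norm_to_bidual_le: "norm (to_bidual x) \<le> norm x"
  by (rule norm_blinfun_bound) (simp_all add: norm_blinfun mult.commute[of "norm x"] flip: real_norm_def)

lemma to_bidual_minus: "to_bidual (- x) = - to_bidual x"
  by (rule blinfun_eqI) (simp add: blinfun.minus_left blinfun.minus_right)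

lemma to_bidual_diff: "to_bidual (x - y) = to_bidual x - to_bidual y"
  by (rule blinfun_eqI) (simp add: blinfun.diff_left blinfun.diff_right)

section \<open>Finite-dimensional and countably spanned subspaces\<close>

text \<open>A convergent sequence is bounded, so it stays in one of the compact sets.\<close>

lemma closed_if_compactly_exhausted:
  fixes S :: "'a::real_normed_vector set"
  assumes ex: "\<And>r. \<exists>K. compact K \<and> K \<subseteq> S \<and> S \<inter> cball 0 r \<subseteq> K"
  shows "closed S"
  unfolding closed_sequential_limits
proof (intro allI impI, elim conjE)
  fix z l
  assume z: "\<forall>n. z n \<in> S" and lim: "z \<longlonglongrightarrow> l"
  then obtain r where r: "\<And>n. norm (z n) \<le> r"
    using convergent_imp_Bseq[of z] unfolding convergent_def Bseq_def by blast
  obtain K where K: "compact K" "K \<subseteq> S" "S \<inter> cball 0 r \<subseteq> K"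
    using ex by blast
  have "\<forall>n. z n \<in> K"
    using z r K(3) by auto
  then have "l \<in> K"
    using closed_sequentially[OF compact_imp_closed[OF K(1)]] lim by blast
  with K(2) show "l \<in> S"
    by blast
qed

text \<open>Local compactness of finite-dimensional subspaces of an arbitrary normed space, by
  induction on a spanning set. By induction \<open>span F\<close> is closed, so a new vector \<open>b\<close> has
  positive distance \<open>\<delta>\<close> from it. This bounds the coefficient of \<open>b\<close>, and with it the component in
  \<open>span F\<close>, of any vector in a ball, which therefore lies in a sum of two compact sets. Asking only
  for a compact set between the ball and the subspace makes this sum a witness as it stands.\<close>

lemma span_finite_compactly_exhausted:
  fixes F :: "'a::real_normed_vector set"
  assumes "finite F"
  shows "\<exists>K. compact K \<and> K \<subseteq> span F \<and> span F \<inter> cball 0 r \<subseteq> K"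
  using assms
proof (induction F arbitrary: r)
  case empty
  show ?case
    by (rule exI[of _ "{0}"]) auto
next
  case (insert b F)
  show ?case
  proof (cases "b \<in> span F")
    case True
    then show ?thesis
      using insert.IH[of r] by (simp add: span_redundant)
  next
    case False
    define \<delta> where "\<delta> = infdist b (span F)"
    have \<delta>: "\<delta> > 0"
      unfolding \<delta>_def using False insert.IH span_zero
      by (intro infdist_pos_not_in_closed closed_if_compactly_exhausted) blast+
    have coeff: "\<bar>a\<bar> * \<delta> \<le> norm (y + a *\<^sub>R b)" if y: "y \<in> span F" for y a
    proof (cases "a = 0")
      case False
      have "- (inverse a *\<^sub>R y) \<in> span F"
        using y by (intro span_neg span_scale)
      then have "\<delta> \<le> norm (b + inverse a *\<^sub>R y)"
        unfolding \<delta>_def using infdist_le[of "- (inverse a *\<^sub>R y)" "span F" b] by (simp add: dist_norm)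
      then have "\<bar>a\<bar> * \<delta> \<le> norm (a *\<^sub>R (b + inverse a *\<^sub>R y))"
        by (simp add: mult_left_mono)
      with False show ?thesis
        by (simp add: scaleR_add_right add.commute)
    qed simp
    define \<rho> where "\<rho> = r / \<delta>"
    obtain K where K: "compact K" "K \<subseteq> span F" "span F \<inter> cball 0 (r + \<rho> * norm b) \<subseteq> K"
      using insert.IH by blast
    define L where "L = {x + y |x y. x \<in> K \<and> y \<in> (\<lambda>a. a *\<^sub>R b) ` {- \<rho>..\<rho>}}"
    have "compact L"
      unfolding L_def
      by (intro compact_sums K(1) compact_continuous_image compact_Icc continuous_intros)
    moreover have "L \<subseteq> span (insert b F)"
      using K(2) span_mono[OF subset_insertI, of F b]
      by (auto simp: L_def intro!: span_add span_scale span_base[of b])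
    moreover have "z \<in> L" if "z \<in> span (insert b F)" "norm z \<le> r" for z
    proof -
      have "\<exists>a. z - a *\<^sub>R b \<in> span F"
        using that(1) by (simp add: span_breakdown_eq)
      then obtain a where a: "z - a *\<^sub>R b \<in> span F"
        by blast
      have "\<bar>a\<bar> * \<delta> \<le> r"
        using coeff[OF a, of a] that(2) by simp
      then have \<rho>: "\<bar>a\<bar> \<le> \<rho>"
        using \<delta> by (simp add: \<rho>_def field_simps)
      have "norm (z - a *\<^sub>R b) \<le> norm z + \<bar>a\<bar> * norm b"
        using norm_triangle_ineq4[of z "a *\<^sub>R b"] by simp
      also have "\<dots> \<le> r + \<rho> * norm b"
        using that(2) \<rho> by (intro add_mono mult_right_mono) auto
      finally have "z - a *\<^sub>R b \<in> K"
        using K(3) a by auto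
      moreover have "a *\<^sub>R b \<in> (\<lambda>a. a *\<^sub>R b) ` {- \<rho>..\<rho>}"
        using \<rho> by (intro imageI) auto
      ultimately show ?thesis
        unfolding L_def by (intro CollectI exI[of _ "z - a *\<^sub>R b"] exI[of _ "a *\<^sub>R b"]) simp
    qed
    ultimately show ?thesis
      by (intro exI[of _ L]) auto
  qed
qed

lemma finite_net_of_unit_sphere:
  fixes Y :: "'a::real_normed_vector set"
  assumes "subspace Y" "finite_dim Y" "\<eta> > 0"
  obtains N where "finite N" "N \<subseteq> Y \<inter> sphere 0 1"
    "\<And>y. y \<in> Y \<Longrightarrow> norm y = 1 \<Longrightarrow> \<exists>z\<in>N. norm (y - z) < \<eta>"
proof -
  obtain F where F: "finite F" "Y = span F"
    using assms(2) unfolding finite_dim_def by blast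
  obtain K where K: "compact K" "K \<subseteq> Y" "Y \<inter> cball 0 1 \<subseteq> K"
    using span_finite_compactly_exhausted[OF F(1)] F(2) by blast
  have "compact (K \<inter> sphere 0 1)"
    using K(1) by (intro compact_Int_closed) (auto simp: sphere_def intro!: closed_Collect_eq continuous_intros)
  moreover have "K \<inter> sphere 0 1 = Y \<inter> sphere 0 1"
    using K by auto
  ultimately have "compact (Y \<inter> sphere 0 1)"
    by simp
  then obtain N where "finite N" "N \<subseteq> Y \<inter> sphere 0 1" "Y \<inter> sphere 0 1 \<subseteq> (\<Union>z\<in>N. ball z \<eta>)"
    using seq_compact_imp_totally_bounded[of "Y \<inter> sphere 0 1"] assms(3)
    by (metis compact_imp_seq_compact)
  with that show thesis
    by (force simp: dist_norm norm_minus_commute)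
qed

text \<open>The combinations with rational coefficients are dense. They are indexed by lists, which makes
  their countability immediate.\<close>

lemma separable_span:
  fixes A :: "'a::real_normed_vector set"
  assumes A: "countable A"
  shows "separable_space (top_of_set (span A))"
proof -
  define D where "D = (\<lambda>l. sum_list (map (\<lambda>(q, a). q *\<^sub>R a) l)) ` lists (\<rat> \<times> A)"
  have "countable D"
    unfolding D_def using A countable_rat by (intro countable_image countable_lists countable_SIGMA) auto
  moreover have sub: "D \<subseteq> span A"
  proof -
    have "sum_list (map (\<lambda>(q, a). q *\<^sub>R a) l) \<in> span A" if "l \<in> lists (\<rat> \<times> A)" for l
      using that
      by (induction l) (auto intro!: span_zero span_add span_scale intro: span_base)
    then show ?thesis
      by (auto simp: D_def)
  qed
  moreover have "x \<in> closure D" if "x \<in> span A" for x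
    using that
  proof (induction rule: span_induct_alt)
    case base
    have "0 \<in> D"
      unfolding D_def by (rule image_eqI[of _ _ "[]"]) auto
    then show ?case
      using closure_subset by blast
  next
    case (step c a y)
    show ?case
      unfolding closure_approachable
    proof (intro allI impI)
      fix e :: real
      assume e: "e > 0"
      have "\<exists>d\<in>D. dist d y < e / 2"
        using step.IH e unfolding closure_approachable by (meson half_gt_zero)
      then obtain l where l: "l \<in> lists (\<rat> \<times> A)"
          "norm (sum_list (map (\<lambda>(q, a). q *\<^sub>R a) l) - y) < e / 2"
        unfolding D_def dist_norm by blast
      define \<delta> where "\<delta> = e / (2 * (norm a + 1))"
      have "norm a + 1 > 0"
        using norm_ge_zero[of a] by linarith
      then have \<delta>: "\<delta> > 0" "\<delta> * (norm a + 1) = e / 2"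
        using e by (simp_all add: \<delta>_def field_simps)
      obtain q where q: "q \<in> \<rat>" "c < q" "q < c + \<delta>"
        using Rats_dense_in_real[of c "c + \<delta>"] \<delta> by auto
      have "norm ((q - c) *\<^sub>R a) \<le> \<delta> * (norm a + 1)"
        using q \<delta> by (auto intro!: mult_mono)
      then have "norm ((q - c) *\<^sub>R a + (sum_list (map (\<lambda>(q, a). q *\<^sub>R a) l) - y)) < e"
        using l(2) \<delta>(2) norm_triangle_ineq[of "(q - c) *\<^sub>R a"
            "sum_list (map (\<lambda>(q, a). q *\<^sub>R a) l) - y"] by linarith
      then have "dist (sum_list (map (\<lambda>(q, a). q *\<^sub>R a) ((q, a) # l))) (c *\<^sub>R a + y) < e"
        by (simp add: dist_norm algebra_simps)
      moreover have "(q, a) # l \<in> lists (\<rat> \<times> A)"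
        using q(1) step.hyps l(1) by auto
      ultimately show "\<exists>d\<in>D. dist d (c *\<^sub>R a + y) < e"
        unfolding D_def by blast
    qed
  qed
  ultimately show ?thesis
    unfolding separable_space_def
    by (intro exI[of _ D]) (auto simp: closure_of_subtopology Int_absorb1)
qed

section \<open>From octahedrality to a bidual functional\<close>

text \<open>Octahedrality with \<open>\<epsilon> = 1 - \<rho> n\<close>, used along a recursive choice.\<close>

lemma octahedral_sequence:
  fixes d :: "nat \<Rightarrow> 'a::real_normed_vector" and \<rho> :: "nat \<Rightarrow> real"
  assumes oct: "octahedral TYPE('a)" and \<rho>: "\<And>n. \<rho> n < 1"
  obtains x where "\<And>n. norm (x n) = 1"
    "\<And>n y t. y \<in> span (d ` {..n} \<union> x ` {..<n}) \<Longrightarrow> \<rho> n * (norm y + \<bar>t\<bar>) \<le> norm (y + t *\<^sub>R x n)"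
proof -
  define P where "P x n z \<longleftrightarrow> norm z = 1 \<and> (\<forall>y \<in> span (d ` {..n} \<union> x ` {..<n}). \<forall>t.
      \<rho> n * (norm y + \<bar>t\<bar>) \<le> norm (y + t *\<^sub>R z))" for x n and z :: 'a
  have "\<exists>x. \<forall>n. P x n (x n)"
  proof (rule dependent_wellorder_choice)
    fix r and f g :: "nat \<Rightarrow> 'a" and n :: nat
    assume "\<And>m. m < n \<Longrightarrow> f m = g m"
    then have "f ` {..<n} = g ` {..<n}"
      by auto
    then show "P f n r = P g n r"
      unfolding P_def by simp
  next
    fix n f
    have "finite_dim (span (d ` {..n} \<union> f ` {..<n}))"
      unfolding finite_dim_def by (intro exI[of _ "d ` {..n} \<union> f ` {..<n}"]) simp
    moreover have "1 - \<rho> n > 0"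
      using \<rho>[of n] by simp
    ultimately obtain z where "z \<in> sphere 0 1"
        "\<forall>y\<in>span (d ` {..n} \<union> f ` {..<n}). \<forall>t. norm (y + t *\<^sub>R z) \<ge> (1 - (1 - \<rho> n)) * (norm y + \<bar>t\<bar>)"
      using oct[unfolded octahedral_def, rule_format,
          of "span (d ` {..n} \<union> f ` {..<n})" "1 - \<rho> n"] subspace_span by blast
    then show "\<exists>z. P f n z"
      unfolding P_def by auto
  qed
  then show thesis
    using that unfolding P_def by blast
qed

text \<open>The factors lost in the choice of the \<open>x i\<close> are written as quotients of consecutive terms of
  \<open>w\<close>, so that their product telescopes. Adding \<open>x (Suc m)\<close> to the combination costs one more factor;
  its own coefficient loses no more than the others because \<open>w\<close> decreases.\<close>

lemma l1_lower_bound: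
  fixes x d :: "nat \<Rightarrow> 'a::real_normed_vector" and w :: "nat \<Rightarrow> real"
  assumes w: "\<And>n. w n > 0" "decseq w"
    and oct: "\<And>n y t. y \<in> span (d ` {..n} \<union> x ` {..<n}) \<Longrightarrow>
      w (Suc n) / w n * (norm y + \<bar>t\<bar>) \<le> norm (y + t *\<^sub>R x n)"
    and b: "\<And>i. b i \<ge> 0" and "j \<le> k" "k \<le> m"
  shows "w (Suc m) / w (Suc k) * (b k * norm (d j) + (\<Sum>i\<in>{k<..m}. b i))
    \<le> norm (b k *\<^sub>R d j + (\<Sum>i\<in>{k<..m}. b i *\<^sub>R x i))"
  using \<open>k \<le> m\<close>
proof (induction m rule: dec_induct)
  case base
  show ?case
    using w(1)[of "Suc k"] b by simp
next
  case (step m)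
  define y where "y = b k *\<^sub>R d j + (\<Sum>i\<in>{k<..m}. b i *\<^sub>R x i)"
  define s where "s = b k * norm (d j) + (\<Sum>i\<in>{k<..m}. b i)"
  have ins: "{k<..Suc m} = insert (Suc m) {k<..m}"
    using step.hyps by auto
  have "y \<in> span (d ` {..Suc m} \<union> x ` {..<Suc m})"
    unfolding y_def using \<open>j \<le> k\<close> step.hyps
    by (intro span_add span_scale span_sum span_base) auto
  then have "w (Suc (Suc m)) / w (Suc m) * (norm y + b (Suc m)) \<le> norm (y + b (Suc m) *\<^sub>R x (Suc m))"
    using oct[of y "Suc m" "b (Suc m)"] b[of "Suc m"] by simp
  moreover have "w (Suc m) / w (Suc k) \<le> 1"
    using w decseqD[OF w(2), of "Suc k" "Suc m"] step.hyps by simp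
  then have "w (Suc m) / w (Suc k) * (s + b (Suc m)) \<le> norm y + b (Suc m)"
    using step.IH b[of "Suc m"] mult_right_mono[of "w (Suc m) / w (Suc k)" 1 "b (Suc m)"]
    unfolding y_def s_def by (simp add: distrib_left)
  then have "w (Suc (Suc m)) / w (Suc m) * (w (Suc m) / w (Suc k) * (s + b (Suc m)))
      \<le> w (Suc (Suc m)) / w (Suc m) * (norm y + b (Suc m))"
    using w(1)[of "Suc m"] w(1)[of "Suc (Suc m)"] by (intro mult_left_mono) auto
  moreover have "w (Suc (Suc m)) / w (Suc m) * (w (Suc m) / w (Suc k) * (s + b (Suc m)))
      = w (Suc (Suc m)) / w (Suc k) * (s + b (Suc m))"
    using w(1)[of "Suc m"] by simp
  ultimately show ?case
    unfolding y_def s_def ins by (simp add: algebra_simps)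
qed

text \<open>The \<open>l1\<close> estimate is the hypothesis of the Mazur--Orlicz theorem for the family \<open>d j\<close>,
  \<open>x (k + 1)\<close>, \<open>x (k + 2)\<close>, and so on. As \<open>w > 1\<close>, the constant \<open>inverse (w (Suc k))\<close> works for
  combinations of any length.\<close>

lemma asymptotically_norming_functional:
  fixes x d :: "nat \<Rightarrow> 'a::real_normed_vector" and w :: "nat \<Rightarrow> real"
  assumes w: "\<And>n. w n > 1" "decseq w"
    and oct: "\<And>n y t. y \<in> span (d ` {..n} \<union> x ` {..<n}) \<Longrightarrow>
      w (Suc n) / w n * (norm y + \<bar>t\<bar>) \<le> norm (y + t *\<^sub>R x n)"
    and "j \<le> k"
  obtains f :: "'a dual" where "norm f \<le> 1" "inverse (w (Suc k)) * norm (d j) \<le> blinfun_apply f (d j)"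
    "\<And>i. i > k \<Longrightarrow> inverse (w (Suc k)) \<le> blinfun_apply f (x i)"
proof -
  \<comment> \<open>The index \<open>k\<close> carries \<open>d j\<close>, so that one family indexed by \<open>{k..}\<close> holds it and the tail of \<open>x\<close>.\<close>
  define v where "v = x(k := d j)"
  define c where "c i = (if i = k then inverse (w (Suc k)) * norm (d j) else inverse (w (Suc k)))" for i
  have w0: "w n > 0" for n
    using w(1)[of n] by linarith
  have "(\<Sum>i\<in>F. a i * c i) \<le> norm (\<Sum>i\<in>F. a i *\<^sub>R v i)"
    if F: "finite F" "F \<subseteq> {k..}" and a: "\<And>i. a i \<ge> 0" for F and a :: "nat \<Rightarrow> real"
  proof -
    define m where "m = Max (insert k F)"
    define b where "b i = (if i \<in> F then a i else 0)" for i
    have km: "k \<le> m" and Fm: "F \<subseteq> insert k {k<..m}"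
    proof -
      show "k \<le> m"
        unfolding m_def using F(1) by simp
      have "i \<le> m" if "i \<in> F" for i
        unfolding m_def using F(1) that by simp
      then show "F \<subseteq> insert k {k<..m}"
        using F(2) by force
    qed
    have b: "b i \<ge> 0" for i
      using a by (simp add: b_def)
    define s where "s = b k * norm (d j) + (\<Sum>i\<in>{k<..m}. b i)"
    have s: "s \<ge> 0"
      unfolding s_def using b by (intro add_nonneg_nonneg mult_nonneg_nonneg sum_nonneg) auto
    have "(\<Sum>i\<in>F. a i * c i) = (\<Sum>i\<in>insert k {k<..m}. b i * c i)"
      using Fm by (intro sum.mono_neutral_cong_left) (auto simp: b_def)
    also have "\<dots> = inverse (w (Suc k)) * s"
      by (simp add: c_def s_def sum_distrib_left sum_distrib_right algebra_simps)
    also have "\<dots> \<le> w (Suc m) / w (Suc k) * s"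
      using w(1)[of "Suc m"] w0[of "Suc k"] s by (intro mult_right_mono) (auto simp: field_simps)
    also have "\<dots> \<le> norm (b k *\<^sub>R d j + (\<Sum>i\<in>{k<..m}. b i *\<^sub>R x i))"
      unfolding s_def using l1_lower_bound[OF w0 w(2) oct b \<open>j \<le> k\<close> km] .
    also have "b k *\<^sub>R d j + (\<Sum>i\<in>{k<..m}. b i *\<^sub>R x i) = (\<Sum>i\<in>insert k {k<..m}. b i *\<^sub>R v i)"
      by (simp add: v_def)
    also have "\<dots> = (\<Sum>i\<in>F. a i *\<^sub>R v i)"
      using Fm by (intro sum.mono_neutral_cong_right) (auto simp: b_def)
    finally show ?thesis .
  qed
  then obtain f :: "'a dual" where f: "norm f \<le> 1" "\<And>i. i \<in> {k..} \<Longrightarrow> c i \<le> blinfun_apply f (v i)"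
    using Mazur_Orlicz_dual[of "{k..}" c v] by metis
  show thesis
  proof (rule that[OF f(1)])
    show "inverse (w (Suc k)) * norm (d j) \<le> blinfun_apply f (d j)"
      using f(2)[of k] by (simp add: c_def v_def)
    show "inverse (w (Suc k)) \<le> blinfun_apply f (x i)" if "i > k" for i
      using f(2)[of i] that by (simp add: c_def v_def)
  qed
qed

text \<open>The Mazur--Orlicz theorem is used a second time, now in the dual: a finite combination of
  the functionals \<open>f j k\<close> is tested on one \<open>x i\<close> with \<open>i\<close> beyond all \<open>k\<close> that occur in it.\<close>

lemma octahedral_bidual_sequence:
  fixes d :: "nat \<Rightarrow> 'a::real_normed_vector"
  assumes "octahedral TYPE('a)"
  obtains g :: "'a bidual" where "norm g \<le> 1"
    "\<And>j t. t \<ge> 0 \<Longrightarrow> norm (d j) + t \<le> norm (to_bidual (d j) + t *\<^sub>R g)"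
proof -
  define w :: "nat \<Rightarrow> real" where "w n = 1 + inverse (real (Suc n))" for n
  have w: "w n > 1" "w (Suc n) < w n" for n
    by (simp_all add: w_def field_simps)
  have dec: "decseq w"
    using w(2) by (simp add: decseq_SucI less_imp_le)
  have "w (Suc n) / w n < 1" for n
    using w[of n] by simp
  then obtain x where x: "\<And>n. norm (x n) = 1"
      "\<And>n y t. y \<in> span (d ` {..n} \<union> x ` {..<n}) \<Longrightarrow>
        w (Suc n) / w n * (norm y + \<bar>t\<bar>) \<le> norm (y + t *\<^sub>R x n)"
    using octahedral_sequence[OF assms, of "\<lambda>n. w (Suc n) / w n" d] by blast
  define c where "c k = inverse (w (Suc k))" for k
  have c: "0 < c k" for k
    using w(1)[of "Suc k"] by (simp add: c_def)
  have "\<exists>f :: 'a dual. norm f \<le> 1 \<and> c k * norm (d j) \<le> blinfun_apply f (d j) \<and>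
      (\<forall>i>k. c k \<le> blinfun_apply f (x i))" if "j \<le> k" for j k
    using asymptotically_norming_functional[OF w(1) dec x(2) that] unfolding c_def by metis
  then obtain f :: "nat \<Rightarrow> nat \<Rightarrow> 'a dual" where f: "\<And>j k. j \<le> k \<Longrightarrow> norm (f j k) \<le> 1"
      "\<And>j k. j \<le> k \<Longrightarrow> c k * norm (d j) \<le> blinfun_apply (f j k) (d j)"
      "\<And>i j k. j \<le> k \<Longrightarrow> k < i \<Longrightarrow> c k \<le> blinfun_apply (f j k) (x i)"
    by metis
  define I where "I = {(j, k). j \<le> (k::nat)}"
  have "(\<Sum>p\<in>F. a p * c (snd p)) \<le> norm (\<Sum>p\<in>F. a p *\<^sub>R case_prod f p)"
    if F: "finite F" "F \<subseteq> I" and a: "\<And>p. a p \<ge> 0" for F and a :: "nat \<times> nat \<Rightarrow> real"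
  proof -
    obtain i where i: "\<And>p. p \<in> F \<Longrightarrow> snd p < i"
      using F(1) finite_nat_set_iff_bounded[of "snd ` F"] by auto
    have "(\<Sum>p\<in>F. a p * c (snd p)) \<le> (\<Sum>p\<in>F. a p * blinfun_apply (case_prod f p) (x i))"
      using F(2) a i f(3) by (intro sum_mono mult_left_mono) (auto simp: I_def)
    also have "\<dots> = blinfun_apply (\<Sum>p\<in>F. a p *\<^sub>R case_prod f p) (x i)"
      by (simp add: blinfun.sum_left blinfun.scaleR_left)
    also have "\<dots> \<le> norm (\<Sum>p\<in>F. a p *\<^sub>R case_prod f p)"
      using blinfun_apply_le[of "\<Sum>p\<in>F. a p *\<^sub>R case_prod f p" "x i"] x(1)[of i] by simp
    finally show ?thesis .
  qed
  from Mazur_Orlicz_dual[of I "\<lambda>p. c (snd p)" "case_prod f", OF this]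
  obtain g :: "'a bidual" where g: "norm g \<le> 1"
      "\<And>p. p \<in> I \<Longrightarrow> c (snd p) \<le> blinfun_apply g (case_prod f p)"
    by blast
  have "norm (d j) + t \<le> norm (to_bidual (d j) + t *\<^sub>R g)" if t: "t \<ge> 0" for j t
  proof -
    have lower: "c k * (norm (d j) + t) \<le> norm (to_bidual (d j) + t *\<^sub>R g)" if "k \<ge> j" for k
    proof -
      have "c k \<le> blinfun_apply g (f j k)"
        using g(2)[of "(j, k)"] that by (simp add: I_def)
      then have "c k * t \<le> t * blinfun_apply g (f j k)"
        using mult_left_mono[OF _ t] by (simp add: mult.commute[of "c k"])
      then have "c k * (norm (d j) + t) \<le> blinfun_apply (to_bidual (d j) + t *\<^sub>R g) (f j k)"
        using f(2)[OF that] by (simp add: blinfun.add_left blinfun.scaleR_left distrib_left)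
      also have "\<dots> \<le> norm (to_bidual (d j) + t *\<^sub>R g) * norm (f j k)"
        by (rule blinfun_apply_le)
      also have "\<dots> \<le> norm (to_bidual (d j) + t *\<^sub>R g)"
        using f(1)[OF that] by (simp add: mult_left_le)
      finally show ?thesis .
    qed
    have "w \<longlonglongrightarrow> 1"
      unfolding w_def using tendsto_add[OF tendsto_const[of 1] LIMSEQ_inverse_real_of_nat] by simp
    then have "c \<longlonglongrightarrow> 1"
      unfolding c_def using tendsto_inverse[OF LIMSEQ_Suc] by fastforce
    then have "(\<lambda>k. c k * (norm (d j) + t)) \<longlonglongrightarrow> 1 * (norm (d j) + t)"
      by (intro tendsto_intros)
    then show ?thesis
      using LIMSEQ_le_const2[of _ "1 * (norm (d j) + t)"] lower by auto
  qed
  with g(1) that show thesis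
    by blast
qed

text \<open>Density extends the lower bound from the sequence to \<open>Y\<close>, and the symmetry \<open>y \<mapsto> - y\<close> to negative
  \<open>t\<close>. The case \<open>y = 0\<close> shows that \<open>g\<close> has norm 1.\<close>

lemma octahedral_imp_bidual:
  fixes Y :: "'a::real_normed_vector set"
  assumes oct: "octahedral TYPE('a)" and Y: "subspace Y" "separable_space (top_of_set Y)"
  shows "\<exists>g \<in> sphere (0 :: 'a bidual) 1. \<forall>y\<in>Y. \<forall>t::real.
    norm (to_bidual y + t *\<^sub>R g) = norm y + \<bar>t\<bar>"
proof -
  obtain U where U: "countable U" "U \<subseteq> Y" "Y \<subseteq> closure U"
    using Y(2) unfolding separable_space_def by (auto simp: closure_of_subtopology Int_absorb1)
  have "U \<noteq> {}"
    using U(3) subspace_0[OF Y(1)] by auto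
  define d where "d = from_nat_into U"
  have d: "range d = U"
    unfolding d_def using range_from_nat_into[OF \<open>U \<noteq> {}\<close> U(1)] .
  obtain g :: "'a bidual" where g: "norm g \<le> 1"
      "\<And>j t. t \<ge> 0 \<Longrightarrow> norm (d j) + t \<le> norm (to_bidual (d j) + t *\<^sub>R g)"
    using octahedral_bidual_sequence[OF oct, of d] by metis
  have pos: "norm y + t \<le> norm (to_bidual y + t *\<^sub>R g)" if y: "y \<in> Y" and t: "t \<ge> 0" for y t
  proof (rule field_le_epsilon)
    fix e :: real
    assume "e > 0"
    moreover have "y \<in> closure U"
      using U(3) y by blast
    ultimately obtain u where u: "u \<in> U" "norm (u - y) < e / 2"
      unfolding closure_approachable dist_norm by (meson half_gt_zero)
    then obtain j where j: "u = d j"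
      using d by blast
    have "norm (to_bidual u + t *\<^sub>R g) \<le> norm (to_bidual y + t *\<^sub>R g) + norm (to_bidual (u - y))"
      using norm_triangle_ineq[of "to_bidual y + t *\<^sub>R g" "to_bidual (u - y)"]
      by (simp add: to_bidual_diff algebra_simps)
    moreover have "norm y \<le> norm u + norm (u - y)"
      using norm_triangle_ineq4[of u "u - y"] by simp
    ultimately show "norm y + t \<le> norm (to_bidual y + t *\<^sub>R g) + e"
      using g(2)[OF t, of j] u(2) norm_to_bidual_le[of "u - y"] unfolding j by linarith
  qed
  have lower: "norm y + \<bar>t\<bar> \<le> norm (to_bidual y + t *\<^sub>R g)" if "y \<in> Y" for y t
  proof (cases "t \<ge> 0")
    case True
    with pos[OF that] show ?thesis
      by simp
  next
    case False
    then have "norm (- y) + \<bar>t\<bar> \<le> norm (to_bidual (- y) + (- t) *\<^sub>R g)"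
      using pos[of "- y" "- t"] subspace_neg[OF Y(1) that] by simp
    also have "to_bidual (- y) + (- t) *\<^sub>R g = - (to_bidual y + t *\<^sub>R g)"
      by (simp add: to_bidual_minus)
    finally show ?thesis
      by (simp only: norm_minus_cancel)
  qed
  have "to_bidual 0 = (0 :: 'a bidual)"
    using norm_to_bidual_le[of "0 :: 'a"] by simp
  then have "norm g = 1"
    using lower[OF subspace_0[OF Y(1)], of 1] g(1) by simp
  moreover have "norm (to_bidual y + t *\<^sub>R g) \<le> norm y + \<bar>t\<bar>" for y t
  proof -
    have "norm (to_bidual y + t *\<^sub>R g) \<le> norm (to_bidual y) + \<bar>t\<bar> * norm g"
      using norm_triangle_ineq[of "to_bidual y" "t *\<^sub>R g"] by simp
    with norm_to_bidual_le[of y] \<open>norm g = 1\<close> show ?thesis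
      by simp
  qed
  ultimately show ?thesis
    using lower by (intro bexI[of _ g]) (auto intro: antisym)
qed

section \<open>The diameter properties of the dual\<close>

text \<open>If \<open>x + g\<close> has norm 2, a unit functional at which it exceeds \<open>1 + t\<close> has both summands above
  \<open>t\<close>, since neither exceeds 1.\<close>

lemma bidual_imp_SD2P_omega:
  assumes bidual: "\<And>Y :: 'a::real_normed_vector set. subspace Y \<Longrightarrow> separable_space (top_of_set Y) \<Longrightarrow>
    \<exists>g \<in> sphere (0 :: 'a bidual) 1. \<forall>y\<in>Y. \<forall>t::real. norm (to_bidual y + t *\<^sub>R g) = norm y + \<bar>t\<bar>"
  shows "dual_weak_star_SD2P_omega TYPE('a)"
  unfolding dual_weak_star_SD2P_omega_def
proof (intro allI impI)
  fix A :: "'a set" and t :: real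
  assume *: "countable A \<and> A \<subseteq> sphere 0 1 \<and> 0 < t \<and> t < 1"
  obtain g :: "'a bidual" where g: "norm g = 1"
      "\<And>y t. y \<in> span A \<Longrightarrow> norm (to_bidual y + t *\<^sub>R g) = norm y + \<bar>t\<bar>"
    using bidual[OF subspace_span separable_span, of A] * by auto
  have "\<exists>f :: 'a dual. norm f = 1 \<and> blinfun_apply f x \<ge> t \<and> blinfun_apply g f \<ge> t" if x: "x \<in> A" for x
  proof -
    have x1: "norm x = 1"
      using x * by auto
    have "1 + t < norm (to_bidual x + 1 *\<^sub>R g)"
      using g(2)[OF span_base[OF x], of 1] x1 * by simp
    then obtain f where f: "norm f = 1" "1 + t < blinfun_apply (to_bidual x + 1 *\<^sub>R g) f"
      using * by (elim unit_vector_above) auto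
    moreover have "blinfun_apply f x \<le> 1" "blinfun_apply g f \<le> 1"
      using blinfun_apply_le[of f x] blinfun_apply_le[of g f] f(1) g(1) x1 by simp_all
    ultimately show ?thesis
      by (intro exI[of _ f]) (simp add: blinfun.add_left)
  qed
  then obtain f :: "'a \<Rightarrow> 'a dual" where f: "\<And>x. x \<in> A \<Longrightarrow> norm (f x) = 1"
      "\<And>x. x \<in> A \<Longrightarrow> blinfun_apply (f x) x \<ge> t" "\<And>x. x \<in> A \<Longrightarrow> blinfun_apply g (f x) \<ge> t"
    by metis
  show "\<exists>B g. B \<subseteq> sphere (0 :: 'a dual) 1 \<and> g \<in> sphere (0 :: 'a bidual) 1 \<and>
      (\<forall>x\<in>A. \<exists>f\<in>B. blinfun_apply f x \<ge> t) \<and> (\<forall>f\<in>B. blinfun_apply g f \<ge> t)"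
    using f g(1) by (intro exI[of _ "f ` A"] exI[of _ g]) auto
qed

text \<open>Functionals in \<open>B\<close> that belong to the respective slices are combined; \<open>g\<close> is at least \<open>s\<close> on
  each of them, hence on the combination.\<close>

lemma SD2P_omega_imp_SD2P:
  assumes om: "dual_weak_star_SD2P_omega TYPE('a::real_normed_vector)"
  shows "dual_weak_star_SD2P TYPE('a)"
  unfolding dual_weak_star_SD2P_def
proof (intro allI impI, elim conjE)
  fix n and c :: "nat \<Rightarrow> real" and S :: "nat \<Rightarrow> 'a dual set" and t :: real
  assume S: "\<forall>i\<in>{1..n}. 0 \<le> c i \<and> weak_star_slice (S i)" and c: "(\<Sum>i = 1..n. c i) = 1"
    and t: "0 < t" "t < 1"
  have "\<forall>i\<in>{1..n}. \<exists>x e. norm x = 1 \<and> 0 < e \<and> e < 1 \<and> S i = slice (to_bidual x) e"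
    using S unfolding weak_star_slice_def by (simp add: Bex_def)
  then obtain x e where xe: "\<And>i. i \<in> {1..n} \<Longrightarrow> norm (x i) = 1" "\<And>i. i \<in> {1..n} \<Longrightarrow> 0 < e i"
      "\<And>i. i \<in> {1..n} \<Longrightarrow> S i = slice (to_bidual (x i)) (e i)"
    by metis
  \<comment> \<open>A functional in the ball that is at least \<open>s\<close> at \<open>x i\<close> lies in \<open>S i\<close>; and \<open>t < s < 1\<close>.\<close>
  define s where "s = Max (insert ((1 + t) / 2) ((\<lambda>i. 1 - e i) ` {1..n}))"
  have s: "t < s" "0 < s" "s < 1" "\<And>i. i \<in> {1..n} \<Longrightarrow> 1 - e i \<le> s"
  proof -
    have "(1 + t) / 2 \<le> s"
      unfolding s_def by (rule Max_ge) auto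
    then show "t < s" "0 < s"
      using t by simp_all
    show "s < 1"
      unfolding s_def using xe(2) t by (subst Max_less_iff) auto
    show "1 - e i \<le> s" if "i \<in> {1..n}" for i
      unfolding s_def using that by (intro Max_ge) auto
  qed
  have "countable (x ` {1..n}) \<and> x ` {1..n} \<subseteq> sphere 0 1 \<and> 0 < s \<and> s < 1"
    using xe(1) s by auto
  then obtain B g where B: "B \<subseteq> sphere (0 :: 'a dual) 1" "g \<in> sphere (0 :: 'a bidual) 1"
      "\<forall>z\<in>x ` {1..n}. \<exists>f\<in>B. s \<le> blinfun_apply f z" "\<forall>f\<in>B. s \<le> blinfun_apply g f"
    using om[unfolded dual_weak_star_SD2P_omega_def, rule_format, of "x ` {1..n}" s] by blast
  then have "\<forall>i\<in>{1..n}. \<exists>f\<in>B. s \<le> blinfun_apply f (x i)"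
    by blast
  then obtain f where f: "\<And>i. i \<in> {1..n} \<Longrightarrow> f i \<in> B" "\<And>i. i \<in> {1..n} \<Longrightarrow> s \<le> blinfun_apply (f i) (x i)"
    by metis
  have f1: "norm (f i) = 1" if "i \<in> {1..n}" for i
    using f(1)[OF that] B(1) by auto
  define h where "h = (\<Sum>i=1..n. c i *\<^sub>R f i)"
  have "h \<in> set_combination n c S"
    unfolding set_combination_def h_def using f f1 s(4) xe(3)
    by (intro CollectI exI[of _ f]) (fastforce simp: slice_def)
  moreover have "norm h \<le> 1"
  proof -
    have "norm h \<le> (\<Sum>i=1..n. c i * 1)"
      unfolding h_def using S f1 by (intro sum_norm_le) auto
    with c show ?thesis
      by simp
  qed
  moreover have "s \<le> norm h"
  proof -
    have "s = (\<Sum>i=1..n. c i * s)"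
      using c by (simp flip: sum_distrib_right)
    also have "\<dots> \<le> (\<Sum>i=1..n. c i * blinfun_apply g (f i))"
      using S B(4) f(1) by (intro sum_mono mult_left_mono) auto
    also have "\<dots> = blinfun_apply g h"
      by (simp add: h_def blinfun.sum_right blinfun.scaleR_right)
    also have "\<dots> \<le> norm h"
      using B(2) by (intro blinfun_unit_ball_le) simp
    finally show ?thesis .
  qed
  moreover have "h \<notin> (*\<^sub>R) t ` cball 0 1"
  proof
    assume "h \<in> (*\<^sub>R) t ` cball 0 1"
    then obtain z where "norm z \<le> 1" "h = t *\<^sub>R z"
      by auto
    then have "norm h \<le> t"
      using t by (simp add: mult_left_le)
    with \<open>s \<le> norm h\<close> s(1) show False
      by simp
  qed
  ultimately show "set_combination n c S \<inter> (cball 0 1 - (*\<^sub>R) t ` cball 0 1) \<noteq> {}"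
    by auto
qed

text \<open>The triangle inequality, applied to \<open>a (x + y) = (a x + b y) + (a - b) y\<close> when \<open>b \<le> a\<close>, reduces
  octahedrality to sums of unit vectors.\<close>

lemma norm_combination_ge:
  fixes x y :: "'a::real_normed_vector"
  assumes "norm x = 1" "norm y = 1" "2 - \<delta> \<le> norm (x + y)" "a \<ge> 0" "b \<ge> 0" "\<delta> \<ge> 0"
  shows "(1 - \<delta>) * (a + b) \<le> norm (a *\<^sub>R x + b *\<^sub>R y)"
proof -
  have *: "(1 - \<delta>) * (a + b) \<le> norm (a *\<^sub>R x + b *\<^sub>R y)"
    if "norm x = 1" "norm y = 1" "2 - \<delta> \<le> norm (x + y)" "0 \<le> b" "b \<le> a" for x y :: 'a and a b
  proof -
    have "a * (2 - \<delta>) \<le> norm (a *\<^sub>R (x + y))"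
      using that by (simp add: mult_left_mono)
    also have "a *\<^sub>R (x + y) = (a *\<^sub>R x + b *\<^sub>R y) + (a - b) *\<^sub>R y"
      by (simp add: algebra_simps)
    also have "norm \<dots> \<le> norm (a *\<^sub>R x + b *\<^sub>R y) + (a - b)"
      using norm_triangle_ineq[of "a *\<^sub>R x + b *\<^sub>R y" "(a - b) *\<^sub>R y"] that by simp
    finally have "a + b - a * \<delta> \<le> norm (a *\<^sub>R x + b *\<^sub>R y)"
      by (simp add: algebra_simps)
    moreover have "0 \<le> b * \<delta>"
      using that \<open>\<delta> \<ge> 0\<close> by simp
    ultimately show ?thesis
      by (simp add: algebra_simps)
  qed
  show ?thesis
    using *[of x y b a] *[of y x a b] assms by (cases "b \<le> a") (auto simp: add.commute)
qed

text \<open>An average of numbers not exceeding 1 that is at least \<open>1 - \<eta> / n\<close> has all its terms at least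
  \<open>1 - \<eta>\<close>. So a unit vector nearly norming a mean of functionals from the slices is nearly norming
  for each functional separately.\<close>

lemma SD2P_common_direction:
  fixes y :: "nat \<Rightarrow> 'a::real_normed_vector"
  assumes sd: "dual_weak_star_SD2P TYPE('a)" and n: "n \<ge> 1"
    and y: "\<And>i. i \<in> {1..n} \<Longrightarrow> norm (y i) = 1" and \<eta>: "0 < \<eta>" "\<eta> < 1"
  obtains x where "norm x = 1" "\<And>i. i \<in> {1..n} \<Longrightarrow> 2 - 2 * \<eta> \<le> norm (y i + x)"
proof -
  define S where "S i = slice (to_bidual (y i)) \<eta>" for i
  define t where "t = 1 - \<eta> / n"
  have "\<eta> / n < 1"
    using n \<eta> by (simp add: field_simps)
  then have t: "0 < t" "t < 1"
    using n \<eta> by (simp_all add: t_def)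
  have "weak_star_slice (S i)" if "i \<in> {1..n}" for i
    unfolding weak_star_slice_def S_def using y[OF that] \<eta> by auto
  then have "set_combination n (\<lambda>_. 1 / n) S \<inter> (cball 0 1 - (*\<^sub>R) t ` cball 0 1) \<noteq> {}"
    using sd t n unfolding dual_weak_star_SD2P_def by auto
  then obtain f where f: "\<And>i. i \<in> {1..n} \<Longrightarrow> f i \<in> S i"
      and out: "(\<Sum>i=1..n. (1 / n) *\<^sub>R f i) \<notin> (*\<^sub>R) t ` cball 0 1"
    unfolding set_combination_def by blast
  define h where "h = (\<Sum>i=1..n. (1 / n) *\<^sub>R f i)"
  have "t < norm h"
  proof (rule ccontr)
    assume "\<not> t < norm h"
    then have "h /\<^sub>R t \<in> cball 0 1"
      using t by (simp add: field_simps)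
    moreover have "h = t *\<^sub>R (h /\<^sub>R t)"
      using t by simp
    ultimately show False
      using out unfolding h_def by blast
  qed
  then obtain x where x: "norm x = 1" "t < blinfun_apply h x"
    using unit_vector_above t by (metis less_imp_le)
  have f1: "norm (f i) \<le> 1" "1 - \<eta> \<le> blinfun_apply (f i) (y i)" if "i \<in> {1..n}" for i
    using f[OF that] by (auto simp: S_def slice_def)
  have fx: "blinfun_apply (f i) x \<le> 1" if "i \<in> {1..n}" for i
    using blinfun_unit_ball_le[OF f1(1)[OF that], of x] x(1) by simp
  have "2 - 2 * \<eta> \<le> norm (y i + x)" if i: "i \<in> {1..n}" for i
  proof -
    have "real n * t < (\<Sum>j=1..n. blinfun_apply (f j) x)"
      using x(2) n by (simp add: h_def blinfun.sum_left blinfun.scaleR_left field_simps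
          flip: sum_divide_distrib)
    also have "\<dots> = blinfun_apply (f i) x + (\<Sum>j\<in>{1..n} - {i}. blinfun_apply (f j) x)"
      using i by (simp add: sum.remove)
    also have "(\<Sum>j\<in>{1..n} - {i}. blinfun_apply (f j) x) \<le> (\<Sum>j\<in>{1..n} - {i}. 1)"
      using fx by (intro sum_mono) auto
    also have "\<dots> = real n - 1"
      using i n by (simp add: of_nat_diff)
    finally have "1 - \<eta> < blinfun_apply (f i) x"
      using n by (simp add: t_def right_diff_distrib)
    then have "2 - 2 * \<eta> \<le> blinfun_apply (f i) (y i + x)"
      using f1(2)[OF i] by (simp add: blinfun.add_right)
    also have "\<dots> \<le> norm (y i + x)"
      using blinfun_unit_ball_le[OF f1(1)[OF i]] .
    finally show ?thesis .
  qed
  with x(1) that show thesis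
    by blast
qed

text \<open>A common direction for an \<open>\<eta>\<close>-net is one for the whole unit sphere, with an additional
  loss of \<open>\<eta>\<close>. The unit vector \<open>e\<close> is added to the net so that there is at least one slice even if
  \<open>Y\<close> is trivial.\<close>

lemma SD2P_imp_octahedral:
  fixes e :: "'a::real_normed_vector"
  assumes sd: "dual_weak_star_SD2P TYPE('a)" and e: "norm e = 1"
  shows "octahedral TYPE('a)"
  unfolding octahedral_def
proof (intro allI impI, elim conjE)
  fix Y :: "'a set" and \<epsilon> :: real
  assume Y: "subspace Y" "finite_dim Y" and \<epsilon>: "\<epsilon> > 0"
  define \<eta> where "\<eta> = min \<epsilon> 1 / 3"
  have \<eta>: "0 < \<eta>" "\<eta> < 1" "3 * \<eta> \<le> \<epsilon>"
    using \<epsilon> by (auto simp: \<eta>_def)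
  obtain N where N: "finite N" "N \<subseteq> Y \<inter> sphere 0 1"
      "\<And>y. y \<in> Y \<Longrightarrow> norm y = 1 \<Longrightarrow> \<exists>z\<in>N. norm (y - z) < \<eta>"
    using finite_net_of_unit_sphere[OF Y \<eta>(1)] by metis
  define n where "n = card (insert e N)"
  obtain z where z: "bij_betw z {1..n} (insert e N)"
    unfolding n_def using ex_bij_betw_nat_finite_1[of "insert e N"] N(1) by auto
  have "n \<ge> 1"
    unfolding n_def using N(1) by (simp add: Suc_le_eq card_gt_0_iff)
  moreover have "norm (z i) = 1" if "i \<in> {1..n}" for i
    using bij_betwE[OF z] that N(2) e by (metis Int_iff insert_iff mem_sphere_0 subsetD)
  ultimately obtain x where x: "norm x = 1" "\<And>i. i \<in> {1..n} \<Longrightarrow> 2 - 2 * \<eta> \<le> norm (z i + x)"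
    using SD2P_common_direction[OF sd _ _ \<eta>(1,2)] by metis
  have unit: "2 - 3 * \<eta> \<le> norm (y + x)" if y: "y \<in> Y" "norm y = 1" for y
  proof -
    obtain u where u: "u \<in> N" "norm (y - u) < \<eta>"
      using N(3) y by blast
    then obtain i where "i \<in> {1..n}" "u = z i"
      using z unfolding bij_betw_def by blast
    then have "2 - 2 * \<eta> \<le> norm (u + x)"
      using x(2) by simp
    also have "\<dots> \<le> norm (y + x) + norm (y - u)"
      using norm_triangle_ineq4[of "y + x" "y - u"] by (simp add: add.commute)
    finally show ?thesis
      using u(2) by simp
  qed
  have pos: "(1 - 3 * \<eta>) * (norm y + t) \<le> norm (y + t *\<^sub>R x)" if y: "y \<in> Y" and t: "t \<ge> 0" for y t
  proof (cases "y = 0")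
    case True
    then show ?thesis
      using t x(1) \<eta>(1) by (simp add: mult_left_le_one_le algebra_simps)
  next
    case False
    define v where "v = y /\<^sub>R norm y"
    have "v \<in> Y" "norm v = 1" "y = norm y *\<^sub>R v"
      using False y Y(1) by (auto simp: v_def subspace_scale)
    then show ?thesis
      using norm_combination_ge[of v x "3 * \<eta>" "norm y" t] unit[of v] x(1) t \<eta>(1) by simp
  qed
  have "(1 - \<epsilon>) * (norm y + \<bar>t\<bar>) \<le> norm (y + t *\<^sub>R x)" if y: "y \<in> Y" for y t
  proof -
    have "(1 - \<epsilon>) * (norm y + \<bar>t\<bar>) \<le> (1 - 3 * \<eta>) * (norm y + \<bar>t\<bar>)"
      using \<eta>(3) by (intro mult_right_mono) auto
    also have "\<dots> \<le> norm (y + t *\<^sub>R x)"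
    proof (cases "t \<ge> 0")
      case True
      with pos[OF y] show ?thesis
        by simp
    next
      case False
      then have "(1 - 3 * \<eta>) * (norm y + \<bar>t\<bar>) \<le> norm (- y + (- t) *\<^sub>R x)"
        using pos[OF subspace_neg[OF Y(1) y], of "- t"] by simp
      also have "- y + (- t) *\<^sub>R x = - (y + t *\<^sub>R x)"
        by simp
      finally show ?thesis
        by (simp only: norm_minus_cancel)
    qed
    finally show ?thesis .
  qed
  with x(1) show "\<exists>x\<in>sphere 0 1. \<forall>y\<in>Y. \<forall>t::real. (1 - \<epsilon>) * (norm y + \<bar>t\<bar>) \<le> norm (y + t *\<^sub>R x)"
    by (intro bexI[of _ x] ballI allI) (simp_all only: mem_sphere_0)
qed

section \<open>The equivalence\<close>

theorem theorem3p10: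
  assumes infinite_dim: "\<not> finite_dim (UNIV :: 'a::banach set)"
  shows "(octahedral TYPE('a) \<longleftrightarrow>
      (\<forall>Y :: 'a set. subspace Y \<and> separable_space (top_of_set Y) \<longrightarrow>
        (\<exists>g \<in> sphere (0 :: 'a bidual) 1. \<forall>y\<in>Y. \<forall>t::real.
          norm (to_bidual y + t *\<^sub>R g) = norm y + \<bar>t\<bar>)))
    \<and> (octahedral TYPE('a) \<longleftrightarrow> dual_weak_star_SD2P TYPE('a))
    \<and> (octahedral TYPE('a) \<longleftrightarrow> dual_weak_star_SD2P_omega TYPE('a))"
proof -
  let ?bidual = "\<forall>Y :: 'a set. subspace Y \<and> separable_space (top_of_set Y) \<longrightarrow>
    (\<exists>g \<in> sphere (0 :: 'a bidual) 1. \<forall>y\<in>Y. \<forall>t::real.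
      norm (to_bidual y + t *\<^sub>R g) = norm y + \<bar>t\<bar>)"
  have "\<exists>x :: 'a. x \<noteq> 0"
  proof (rule ccontr)
    assume "\<not> ?thesis"
    then have "(UNIV :: 'a set) = span {}"
      by auto
    with infinite_dim show False
      unfolding finite_dim_def by blast
  qed
  then obtain x :: 'a where "x \<noteq> 0"
    by blast
  then have "norm (x /\<^sub>R norm x) = 1"
    by simp
  then have "dual_weak_star_SD2P TYPE('a) \<Longrightarrow> octahedral TYPE('a)"
    using SD2P_imp_octahedral by blast
  moreover have "octahedral TYPE('a) \<Longrightarrow> ?bidual"
    using octahedral_imp_bidual by blast
  moreover have "?bidual \<Longrightarrow> dual_weak_star_SD2P_omega TYPE('a)"
    using bidual_imp_SD2P_omega by blast
  moreover have "dual_weak_star_SD2P_omega TYPE('a) \<Longrightarrow> dual_weak_star_SD2P TYPE('a)"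
    using SD2P_omega_imp_SD2P by blast
  ultimately show ?thesis
    by argo
qed

end
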